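(* There are posets with boolean dimension $4$ and unbounded local dimension. That is, for every positive integer $m$ there exists a poset whose boolean dimension is $4$ and whose local dimension is greater than $m$.
   Context: Let $P=(X,\leq)$ be a poset. Boolean dimension: a boolean realizer of $P$ is a set $\{\leq_1,\ldots,\leq_d\}$ of (arbitrary) linear orders on $X$ for which there is a $d$-ary boolean formula $\phi$ such that for all $x,y\in X$: $x\leq y$ if and only if $\phi\bigl((x\leq_1 y),\ldots,(x\leq_d y)\bigr)$ is true, where $(x\leq_i y)$ denotes the truth value of $x\leq_i y$. The boolean dimension of $P$ is the minimum size of a boolean realizer of $P$. Local dimension: a partial linear extension of $\leq$ is a linear extension of the restriction of $\leq$ to some subset of $X$. A local realizer of $P$ of width $d$ is a set $\{\leq_1,\ldots,\leq_t\}$ of partial linear extensions of $\leq$ such that every element of $X$ occurs in (the ground sets of) at most $d$ of $\leq_1,\ldots,\leq_t$, and for all $x,y\in X$: $x\leq y$ if and only if there is no $i\in\{1,\ldots,t\}$ with $x>_i y$ (where $x>_i y$ means that both $x$ and $y$ occur in $\leq_i$ and $x$ is strictly greater than $y$ there). The local dimension of $P$ is the minimum width of a local realizer of $P$. *)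

theory Defs
  imports Main "HOL-Library.Extended_Nat"
begin

text \<open>
  A poset is a pair of a ground set \<open>X\<close> and a relation \<open>P\<close> with \<open>partial_order_on X P\<close>;
  \<open>(x, y) \<in> P\<close> stands for \<open>x \<le> y\<close>.
\<close>

datatype bform =
    Const bool
  | Var nat
  | Neg bform
  | Conj bform bform
  | Disj bform bform

primrec bvars :: "bform \<Rightarrow> nat set" where
  "bvars (Const b) = {}"
| "bvars (Var i) = {i}"
| "bvars (Neg \<phi>) = bvars \<phi>"
| "bvars (Conj \<phi> \<psi>) = bvars \<phi> \<union> bvars \<psi>"
| "bvars (Disj \<phi> \<psi>) = bvars \<phi> \<union> bvars \<psi>"

primrec beval :: "(nat \<Rightarrow> bool) \<Rightarrow> bform \<Rightarrow> bool" where
  "beval v (Const b) = b"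
| "beval v (Var i) = v i"
| "beval v (Neg \<phi>) = (\<not> beval v \<phi>)"
| "beval v (Conj \<phi> \<psi>) = (beval v \<phi> \<and> beval v \<psi>)"
| "beval v (Disj \<phi> \<psi>) = (beval v \<phi> \<or> beval v \<psi>)"

text \<open>
  The list \<open>Ls\<close> enumerates the realizer without repetition, so that variable \<open>i\<close> of the
  formula can refer to its \<open>i\<close>-th order (counting from 0).
\<close>

definition boolean_realizer :: "'a set \<Rightarrow> 'a rel \<Rightarrow> 'a rel set \<Rightarrow> bool" where
  "boolean_realizer X P R \<longleftrightarrow>
     (\<forall>L\<in>R. linear_order_on X L) \<and>
     (\<exists>Ls \<phi>. distinct Ls \<and> set Ls = R \<and> bvars \<phi> \<subseteq> {..<length Ls} \<and>
        (\<forall>x\<in>X. \<forall>y\<in>X. (x, y) \<in> P \<longleftrightarrow> beval (\<lambda>i. (x, y) \<in> Ls ! i) \<phi>))"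

text \<open>Both dimensions are \<open>\<infinity>\<close> if there is no realizer, since \<open>Inf {} = \<infinity>\<close> in \<open>enat\<close>.\<close>

definition boolean_dimension :: "'a set \<Rightarrow> 'a rel \<Rightarrow> enat" where
  "boolean_dimension X P = Inf {enat (card R) | R. boolean_realizer X P R}"

text \<open>
  A linear order is reflexive on its ground set, so the latter is its \<open>Field\<close>.
\<close>

definition partial_linear_extension :: "'a set \<Rightarrow> 'a rel \<Rightarrow> 'a rel \<Rightarrow> bool" where
  "partial_linear_extension X P L \<longleftrightarrow>
     Field L \<subseteq> X \<and> linear_order_on (Field L) L \<and> Restr P (Field L) \<subseteq> L"

definition local_realizer :: "'a set \<Rightarrow> 'a rel \<Rightarrow> nat \<Rightarrow> 'a rel set \<Rightarrow> bool" where
  "local_realizer X P d R \<longleftrightarrow>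
     finite R \<and>
     (\<forall>L\<in>R. partial_linear_extension X P L) \<and>
     (\<forall>x\<in>X. card {L \<in> R. x \<in> Field L} \<le> d) \<and>
     (\<forall>x\<in>X. \<forall>y\<in>X. (x, y) \<in> P \<longleftrightarrow> \<not> (\<exists>L\<in>R. (y, x) \<in> L \<and> y \<noteq> x))"

definition local_dimension :: "'a set \<Rightarrow> 'a rel \<Rightarrow> enat" where
  "local_dimension X P = Inf {enat d | d. \<exists>R. local_realizer X P d R}"

end

theory Submission
  imports Defs "HOL-Library.Ramsey" "HOL-Library.Countable" "HOL-Library.Product_Lexorder"
begin

text \<open>
  Take two copies \<open>a(x,y)\<close>, \<open>b(x,y)\<close> of an \<open>N \<times> N\<close> grid, with \<open>a(x,y) < b(x',y')\<close> iff \<open>x < x'\<close> or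
  \<open>y < y'\<close>. Two linear orders recognise the pairs (lower copy, upper copy), and two more compare the
  coordinates, so the boolean dimension is at most 4.

  In a local realizer, every incomparable pair \<open>a(x',y')\<close>, \<open>b(x,y)\<close> with \<open>x < x'\<close> and \<open>y < y'\<close> is
  reversed by some partial linear extension. If each vertex occurs in at most \<open>m\<close> of these, number
  them locally at each vertex and colour the pair by the two numbers that its extension gets. On a
  subgrid that is monochromatic by the product Ramsey theorem, pairs sharing a vertex are
  reversed by the same extension; but this cannot hold for the whole subgrid.

  The antidiagonal of the grid is a standard example. In a boolean realizer of size at most 3,
  on a subsequence along which all truth values are homogeneous, the truth vector of some comparable
  pair agrees with that of an incomparable or reversed pair.
\<close>

section \<open>Ramsey theorems for pairs and for products of pairs\<close>

text \<open>Ramsey's theorem for 2-subsets: \<open>e\<close> numbers the colours, and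
  \<open>Min\<close> and \<open>Max\<close> turn a 2-subset into an increasing pair.
  \<open>M\<close> is quantified before \<open>f\<close> because the grid size must be fixed before
  the realizer that induces the colouring.\<close>

lemma ramsey_pairs:
  fixes C :: "'a set" and k :: nat
  assumes "finite C"
  shows "\<exists>M::nat. \<forall>f. (\<forall>i j. i < j \<and> j < M \<longrightarrow> f i j \<in> C) \<longrightarrow>
           (\<exists>h c. strict_mono_on {..<k} h \<and> h ` {..<k} \<subseteq> {..<M} \<and>
                  (\<forall>i j. i < j \<and> j < k \<longrightarrow> f (h i) (h j) = c))"
proof -
  obtain e where e: "bij_betw e C {..<card C}"
    using ex_bij_betw_finite_nat[OF assms] by (auto simp: atLeast0LessThan)
  obtain M :: nat where M: "partn_lst {..<M} (replicate (card C) k) 2"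
    using ramsey_full by blast
  show ?thesis
  proof (intro exI[of _ M] allI impI)
    fix f :: "nat \<Rightarrow> nat \<Rightarrow> 'a"
    assume f: "\<forall>i j. i < j \<and> j < M \<longrightarrow> f i j \<in> C"
    define g where "g S = e (f (Min S) (Max S))" for S
    have "g \<in> nsets {..<M} 2 \<rightarrow> {..<card C}"
    proof
      fix S assume "S \<in> nsets {..<M} 2"
      then obtain i j where "S = {i, j}" "i < j" "j < M"
        unfolding ordered_nsets_2_eq by auto
      then show "g S \<in> {..<card C}"
        using f bij_betwE[OF e] by (auto simp: g_def)
    qed
    then obtain i H where i: "i < card C" and H: "H \<in> nsets {..<M} k"
      and mono: "g ` nsets H 2 \<subseteq> {i}"
      using partn_lstE[OF M, of g "card C"] by (metis length_replicate nth_replicate)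
    have H': "H \<subseteq> {..<M}" "finite H" "card H = k"
      using H by (auto simp: nsets_def)
    then obtain h where h: "bij_betw h {..<k} H" "strict_mono_on {..<k} h"
      using ex_bij_betw_strict_mono_card by metis
    have "f (h a) (h b) = inv_into C e i" if ab: "a < b" "b < k" for a b
    proof -
      have lt: "h a < h b"
        using h(2) ab by (auto simp: strict_mono_on_def)
      have mem: "h a \<in> H" "h b \<in> H"
        using h(1) ab by (auto dest: bij_betwE)
      then have "{h a, h b} \<in> nsets H 2"
        using lt by simp
      then have "g {h a, h b} = i"
        using mono by blast
      then have "e (f (h a) (h b)) = i"
        using lt by (simp add: g_def)
      moreover have "f (h a) (h b) \<in> C"
        using f lt mem H' by blast
      ultimately show ?thesis
        using e by (metis bij_betw_inv_into_left)
    qed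
    then show "\<exists>h c. strict_mono_on {..<k} h \<and> h ` {..<k} \<subseteq> {..<M} \<and>
                  (\<forall>i j. i < j \<and> j < k \<longrightarrow> f (h i) (h j) = c)"
      using h H' by (metis bij_betw_imp_surj_on)
  qed
qed

text \<open>Apply Ramsey's theorem twice. First colour a pair \<open>y < y'\<close> by the whole
  table of colours of the pairs \<open>x < x'\<close> below \<open>A\<close>; restricting the table
  to \<open>T\<close> puts it into a finite function space. On a homogeneous set the table is
  constant, and it is then itself a colouring of pairs, to which the theorem applies again.\<close>

lemma product_ramsey_pairs:
  fixes C :: "'a set" and k :: nat
  assumes "finite C" and "k \<ge> 2"
  shows "\<exists>M::nat. \<forall>f. (\<forall>x x' y y'. x < x' \<and> x' < M \<and> y < y' \<and> y' < M \<longrightarrow> f x x' y y' \<in> C) \<longrightarrow>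
           (\<exists>g h c. strict_mono_on {..<k} g \<and> g ` {..<k} \<subseteq> {..<M} \<and>
                    strict_mono_on {..<k} h \<and> h ` {..<k} \<subseteq> {..<M} \<and>
                  (\<forall>i j i' j'. i < j \<and> j < k \<and> i' < j' \<and> j' < k \<longrightarrow>
                     f (g i) (g j) (h i') (h j') = c))"
proof -
  obtain A :: nat where A: "\<forall>f. (\<forall>i j. i < j \<and> j < A \<longrightarrow> f i j \<in> C) \<longrightarrow>
           (\<exists>h c. strict_mono_on {..<k} h \<and> h ` {..<k} \<subseteq> {..<A} \<and>
                  (\<forall>i j. i < j \<and> j < k \<longrightarrow> f (h i) (h j) = c))"
    using ramsey_pairs[OF assms(1), of k] by (rule exE)
  define T where "T = {(x, x'). x < x' \<and> x' < A}"
  have "finite T"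
    by (rule finite_subset[of _ "{..<A} \<times> {..<A}"]) (auto simp: T_def)
  then have "finite (T \<rightarrow>\<^sub>E C)"
    using assms(1) by (simp add: finite_PiE)
  from ramsey_pairs[OF this]
  obtain B :: nat where B: "\<forall>f. (\<forall>i j. i < j \<and> j < B \<longrightarrow> f i j \<in> T \<rightarrow>\<^sub>E C) \<longrightarrow>
           (\<exists>h c. strict_mono_on {..<k} h \<and> h ` {..<k} \<subseteq> {..<B} \<and>
                  (\<forall>i j. i < j \<and> j < k \<longrightarrow> f (h i) (h j) = c))"
    by (rule exE)
  show ?thesis
  proof (intro exI[of _ "max A B"] allI impI)
    fix f :: "nat \<Rightarrow> nat \<Rightarrow> nat \<Rightarrow> nat \<Rightarrow> 'a"
    assume f: "\<forall>x x' y y'. x < x' \<and> x' < max A B \<and> y < y' \<and> y' < max A B \<longrightarrow> f x x' y y' \<in> C"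
    define F where "F y y' = restrict (\<lambda>(x, x'). f x x' y y') T" for y y'
    have F: "\<forall>i j. i < j \<and> j < B \<longrightarrow> F i j \<in> T \<rightarrow>\<^sub>E C"
      using f by (auto simp: F_def T_def less_max_iff_disj)
    obtain h c where h: "strict_mono_on {..<k} h" "h ` {..<k} \<subseteq> {..<B}"
      and c: "\<And>i j. i < j \<Longrightarrow> j < k \<Longrightarrow> F (h i) (h j) = c"
      using mp[OF spec[OF B] F] by (elim exE conjE) (rule that, assumption, assumption, simp)
    have c': "f x x' (h i) (h j) = c (x, x')" if "x < x'" "x' < A" "i < j" "j < k" for x x' i j
      using fun_cong[OF c[OF that(3,4)], of "(x, x')"] that by (simp add: F_def T_def)
    \<comment> \<open>One increasing pair in the range of \<open>h\<close> is needed to see that the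
      common table \<open>c\<close> has its values in \<open>C\<close>; here
      \<open>k \<ge> 2\<close> enters.\<close>
    have "h 0 < h 1" "h 1 < B"
      using h assms(2) by (auto simp: strict_mono_on_def image_subset_iff)
    then have cC: "\<forall>x x'. x < x' \<and> x' < A \<longrightarrow> c (x, x') \<in> C"
      using f c'[of _ _ 0 1] assms(2)
      by (metis One_nat_def Suc_1 Suc_le_lessD less_max_iff_disj zero_less_one)
    obtain g d where g: "strict_mono_on {..<k} g" "g ` {..<k} \<subseteq> {..<A}"
      and d: "\<And>i j. i < j \<Longrightarrow> j < k \<Longrightarrow> c (g i, g j) = d"
      using mp[OF spec[OF A, of "\<lambda>x x'. c (x, x')"] cC]
      by (elim exE conjE) (rule that, assumption, assumption, simp)
    have "f (g i) (g j) (h i') (h j') = d" if "i < j" "j < k" "i' < j'" "j' < k" for i j i' j'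
    proof -
      have "g i < g j" "g j < A"
        using g that by (auto simp: strict_mono_on_def image_subset_iff)
      then show ?thesis
        using c' d that by simp
    qed
    moreover have "g ` {..<k} \<subseteq> {..<max A B}" "h ` {..<k} \<subseteq> {..<max A B}"
      using g(2) h(2) by (auto simp: image_subset_iff less_max_iff_disj)
    ultimately show "\<exists>g h c. strict_mono_on {..<k} g \<and> g ` {..<k} \<subseteq> {..<max A B} \<and>
                    strict_mono_on {..<k} h \<and> h ` {..<k} \<subseteq> {..<max A B} \<and>
                  (\<forall>i j i' j'. i < j \<and> j < k \<and> i' < j' \<and> j' < k \<longrightarrow>
                     f (g i) (g j) (h i') (h j') = c)"
      using g(1) h(1) by (intro exI[of _ g] exI[of _ h] exI[of _ d]) simp
  qed
qed

section \<open>Boolean realizers of size at most three\<close>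

lemma beval_cong: "(\<And>i. i \<in> bvars \<phi> \<Longrightarrow> v i = w i) \<Longrightarrow> beval v \<phi> = beval w \<phi>"
  by (induction \<phi>) auto

lemma linear_order_on_key:
  fixes key :: "'a \<Rightarrow> 'b::linorder"
  assumes "inj_on key A"
  shows "linear_order_on A {(u, v). u \<in> A \<and> v \<in> A \<and> key u \<le> key v}"
  using assms
  by (auto simp: linear_order_on_def partial_order_on_def preorder_on_def refl_on_def
      trans_def antisym_def total_on_def dest: inj_onD)

text \<open>Pairs with equal truth vectors are both in \<open>P\<close> or both outside it.
  Separating the diagonal pair \<open>(a 0, b 0)\<close> from both \<open>(a 0, b 1)\<close> and
  \<open>(a 1, b 0)\<close> already takes two orders whose behaviour is then largely forced, and a
  single further order cannot make all the remaining separations.\<close>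

lemma no_ternary_boolean_realizer:
  fixes a b :: "nat \<Rightarrow> 'a" and Ls :: "'a rel list"
  defines "v \<equiv> \<lambda>x y. map (\<lambda>L. (x, y) \<in> L) Ls"
  assumes lin: "\<And>L. L \<in> set Ls \<Longrightarrow> linear_order_on X L"
    and len: "length Ls \<le> 3"
    and vars: "bvars \<phi> \<subseteq> {..<length Ls}"
    and real: "\<And>x y. x \<in> X \<Longrightarrow> y \<in> X \<Longrightarrow> (x, y) \<in> P \<longleftrightarrow> beval (\<lambda>i. (x, y) \<in> Ls ! i) \<phi>"
    and aX: "\<And>i. i < 3 \<Longrightarrow> a i \<in> X" and bX: "\<And>i. i < 3 \<Longrightarrow> b i \<in> X"
    and a_eq: "\<And>i j. i < 3 \<Longrightarrow> j < 3 \<Longrightarrow> a i = a j \<Longrightarrow> i = j"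
    and ab_neq: "\<And>i j. i < 3 \<Longrightarrow> j < 3 \<Longrightarrow> a i \<noteq> b j"
    and ab: "\<And>i j. i < 3 \<Longrightarrow> j < 3 \<Longrightarrow> (a i, b j) \<in> P \<longleftrightarrow> i \<noteq> j"
    and ba: "\<And>i j. i < 3 \<Longrightarrow> j < 3 \<Longrightarrow> (b i, a j) \<notin> P"
    and aa: "\<And>i j. i < 3 \<Longrightarrow> j < 3 \<Longrightarrow> i \<noteq> j \<Longrightarrow> (a i, a j) \<notin> P"
    and hom: "\<And>i j. i < j \<Longrightarrow> j < 3 \<Longrightarrow>
       (v (a i) (b j), v (a j) (b i), v (a i) (b i), v (a i) (a j)) = c"
  shows False
proof -
  define d where "d = length Ls"
  define le where "le k x y \<longleftrightarrow> (x, y) \<in> Ls ! k" for k x y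
  have lin': "linear_order_on X (Ls ! k)" if "k < d" for k
    using lin that by (simp add: d_def)
  have tr: "le k x z" if "le k x y" "le k y z" "k < d" for k x y z
    using lin'[OF that(3)] that(1,2) unfolding le_def
    by (meson linear_order_on_def partial_order_on_def preorder_on_def transD)
  have asym: "x = y" if "le k x y" "le k y x" "k < d" for k x y
    using lin'[OF that(3)] that(1,2) unfolding le_def
    by (meson linear_order_on_def partial_order_on_def antisymD)
  have tot: "le k x y" if "\<not> le k y x" "k < d" "x \<in> X" "y \<in> X" "x \<noteq> y" for k x y
    using lin'[OF that(2)] that(1,3-) unfolding le_def
    by (metis linear_order_on_def total_on_def)
  have neg: "le k x y \<longleftrightarrow> \<not> le k y x" if "k < d" "x \<in> X" "y \<in> X" "x \<noteq> y" for k x y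
    using asym tot that by blast
  have v_eq: "le k x y \<longleftrightarrow> le k x' y'" if "v x y = v x' y'" "k < d" for k x y x' y'
    using arg_cong[OF that(1), of "\<lambda>xs. xs ! k"] that(2) by (simp add: v_def le_def d_def)
  have P_iff: "(x, y) \<in> P \<longleftrightarrow> beval (\<lambda>i. le i x y) \<phi>" if "x \<in> X" "y \<in> X" for x y
    using real[OF that] by (simp add: le_def)
  have P_cong: "(x, y) \<in> P \<longleftrightarrow> (x', y') \<in> P"
    if "\<And>k. k < d \<Longrightarrow> le k x y \<longleftrightarrow> le k x' y'" "x \<in> X" "y \<in> X" "x' \<in> X" "y' \<in> X" for x y x' y'
    using P_iff beval_cong[of \<phi> "\<lambda>i. le i x y" "\<lambda>i. le i x' y'"] that vars
    by (auto simp: d_def)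
  have p: "le k (a 0) (b 1) \<longleftrightarrow> le k (a 1) (b 2)" "le k (a 1) (b 0) \<longleftrightarrow> le k (a 2) (b 1)"
    "le k (a 0) (b 0) \<longleftrightarrow> le k (a 1) (b 1)" "le k (a 0) (a 1) \<longleftrightarrow> le k (a 0) (a 2)"
    if "k < d" for k
    using hom[of 0 1] hom[of 1 2] hom[of 0 2] that by (auto intro!: v_eq)
  \<comment> \<open>Otherwise \<open>a 0\<close>, \<open>b 1\<close>, \<open>a 1\<close>,
    \<open>b 0\<close> form a cycle in the order \<open>k\<close>, in one direction or the other, so
    \<open>a 0 = a 1\<close>.\<close>
  have r: "le k (a 0) (b 0) \<longleftrightarrow> le k (a 0) (b 1)"
    if "k < d" "le k (a 0) (b 1) \<longleftrightarrow> le k (a 1) (b 0)" for k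
  proof (rule ccontr)
    assume ne: "\<not> ?thesis"
    have "le k (a 0) (a 1) \<and> le k (a 1) (a 0)"
    proof (cases "le k (a 0) (b 1)")
      case True
      then have "le k (b 0) (a 0)" "le k (b 1) (a 1)" "le k (a 1) (b 0)"
        using ne p(3) that neg[of k "b 0" "a 0"] neg[of k "b 1" "a 1"] aX bX
          ab_neq[of 0 0] ab_neq[of 1 1] by auto
      with True show ?thesis
        using tr that(1) by blast
    next
      case False
      then have "le k (a 0) (b 0)" "le k (a 1) (b 1)" "le k (b 0) (a 1)" "le k (b 1) (a 0)"
        using ne p(3) that neg[of k "b 0" "a 1"] neg[of k "b 1" "a 0"] aX bX
          ab_neq[of 1 0] ab_neq[of 0 1] by auto
      then show ?thesis
        using tr that(1) by blast
    qed
    then show False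
      using asym[of k "a 0" "a 1"] a_eq[of 0 1] that by auto
  qed
  \<comment> \<open>The third index enters: by homogeneity \<open>b 1\<close> lies between
    \<open>a 0\<close> and \<open>a 2\<close> in the order \<open>k\<close>, and \<open>a 0\<close>
    compares with \<open>a 2\<close> as with \<open>a 1\<close>.\<close>
  have s: "le k (a 0) (a 1) \<longleftrightarrow> le k (a 0) (b 1)"
    if k: "k < d" and ne: "le k (a 0) (b 1) \<noteq> le k (a 1) (b 0)" for k
  proof (cases "le k (a 0) (b 1)")
    case True
    then have "le k (b 1) (a 2)"
      using ne p(2) k neg[of k "b 1" "a 2"] aX bX ab_neq[of 2 1] by auto
    then show ?thesis
      using True tr k p(4) by blast
  next
    case False
    then have "le k (b 1) (a 0)" "le k (a 2) (b 1)"
      using ne p(2) k neg[of k "b 1" "a 0"] aX bX ab_neq[of 0 1] by auto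
    then have "le k (a 2) (a 0)"
      using tr k by blast
    then show ?thesis
      using False p(4) k asym[of k "a 2" "a 0"] a_eq[of 2 0] by auto
  qed
  \<comment> \<open>At least two coordinates distinguish \<open>(a 0, b 1)\<close> from \<open>(a 1, b 0)\<close>, so at most one does not.\<close>
  have "\<exists>k<d. le k (a 0) (b 0) \<noteq> le k (a 0) (b 1)"
    using P_cong[of "a 0" "b 0" "a 0" "b 1"] ab[of 0 0] ab[of 0 1] aX bX by auto
  then obtain k1 where k1: "k1 < d" "le k1 (a 0) (b 0) \<noteq> le k1 (a 0) (b 1)" by blast
  have "\<exists>k<d. le k (a 0) (b 0) \<noteq> le k (a 1) (b 0)"
    using P_cong[of "a 0" "b 0" "a 1" "b 0"] ab[of 0 0] ab[of 1 0] aX bX by auto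
  then obtain k2 where k2: "k2 < d" "le k2 (a 0) (b 0) \<noteq> le k2 (a 1) (b 0)" by blast
  \<comment> \<open>If \<open>k1 = k2\<close>, both off-diagonal truth values would be the negation
    of the diagonal one, hence equal to each other, against \<open>r\<close>.\<close>
  have "k1 \<noteq> k2" "le k1 (a 0) (b 1) \<noteq> le k1 (a 1) (b 0)" "le k2 (a 0) (b 1) \<noteq> le k2 (a 1) (b 0)"
    using k1 k2 r by blast+
  moreover obtain k3 where k3: "\<And>k. k < d \<Longrightarrow> k = k1 \<or> k = k2 \<or> k = k3"
  proof
    \<comment> \<open>The indices 0, 1, 2 add up to 3, so this is the remaining index. It may fail
      to be below \<open>d\<close>, hence the implication in the first case below.\<close>
    show "k = k1 \<or> k = k2 \<or> k = 3 - k1 - k2" if "k < d" for k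
      using that k1(1) k2(1) \<open>k1 \<noteq> k2\<close> len unfolding d_def by linarith
  qed
  ultimately have ne: "le k (a 0) (b 1) \<noteq> le k (a 1) (b 0)" if "k < d" "k \<noteq> k3" for k
    using that by blast
  have nba: "le k (b 1) (a 0) \<longleftrightarrow> \<not> le k (a 0) (b 1)" if "k < d" for k
    using neg[of k "b 1" "a 0"] aX bX ab_neq[of 0 1] that by auto
  have naa: "le k (a 1) (a 0) \<longleftrightarrow> \<not> le k (a 0) (a 1)" if "k < d" for k
    using neg[OF that aX aX, of 1 0] a_eq[of 1 0] by auto
  \<comment> \<open>The coinciding truth vectors are those of \<open>(b 1, a 0)\<close> and
    \<open>(a 1, b 0)\<close>, of \<open>(a 0, a 1)\<close> and \<open>(a 0, b 1)\<close>, and of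
    \<open>(a 1, a 0)\<close> and \<open>(a 1, b 0)\<close>, respectively. In each case only the
    second pair is in \<open>P\<close>.\<close>
  consider "k3 < d \<longrightarrow> le k3 (a 0) (b 1) \<noteq> le k3 (a 1) (b 0)"
    | "le k3 (a 0) (b 1) = le k3 (a 1) (b 0)" "le k3 (a 0) (a 1) = le k3 (a 0) (b 1)"
    | "le k3 (a 0) (b 1) = le k3 (a 1) (b 0)" "le k3 (a 0) (a 1) \<noteq> le k3 (a 0) (b 1)"
    by blast
  then show False
  proof cases
    case 1
    then have "le k (b 1) (a 0) \<longleftrightarrow> le k (a 1) (b 0)" if "k < d" for k
      using nba[OF that] ne[OF that] that by blast
    then show False
      using P_cong[of "b 1" "a 0" "a 1" "b 0"] ab[of 1 0] ba[of 1 0] aX bX by auto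
  next
    case 2
    then have "le k (a 0) (a 1) \<longleftrightarrow> le k (a 0) (b 1)" if "k < d" for k
      using s[OF that] ne[OF that] by blast
    then show False
      using P_cong[of "a 0" "a 1" "a 0" "b 1"] ab[of 0 1] aa[of 0 1] aX bX by auto
  next
    case 3
    then have "le k (a 1) (a 0) \<longleftrightarrow> le k (a 1) (b 0)" if "k < d" for k
      using s[OF that] ne[OF that] naa[OF that] by blast
    then show False
      using P_cong[of "a 1" "a 0" "a 1" "b 0"] ab[of 1 0] aa[of 1 0] aX bX by auto
  qed
qed

section \<open>The grid poset\<close>

text \<open>The final poset lives on the natural numbers, so tagged grid points are encoded by
  \<open>to_nat\<close>. The tag \<open>False\<close> marks the lower copy a, \<open>True\<close>
  the upper copy b.\<close>

definition vert :: "bool \<Rightarrow> nat \<Rightarrow> nat \<Rightarrow> nat" where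
  "vert s x y = to_nat (s, x, y)"

definition grid :: "nat \<Rightarrow> nat set" where
  "grid N = {vert s x y | s x y. x < N \<and> y < N}"

definition grid_order :: "nat \<Rightarrow> nat rel" where
  "grid_order N = {(u, v). u \<in> grid N \<and> v \<in> grid N \<and>
     (u = v \<or> (\<exists>x y x' y'. u = vert False x y \<and> v = vert True x' y' \<and> (x < x' \<or> y < y')))}"

lemma vert_eq_iff [simp]: "vert s x y = vert s' x' y' \<longleftrightarrow> s = s' \<and> x = x' \<and> y = y'"
  by (simp add: vert_def)

lemma from_nat_vert [simp]: "from_nat (vert s x y) = (s, x, y)"
  by (simp add: vert_def)

lemma vert_in_grid [simp]: "vert s x y \<in> grid N \<longleftrightarrow> x < N \<and> y < N"
  by (auto simp: grid_def)

lemma vert_grid_order_iff: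
  "(vert s x y, vert s' x' y') \<in> grid_order N \<longleftrightarrow>
     x < N \<and> y < N \<and> x' < N \<and> y' < N \<and>
     (s = s' \<and> x = x' \<and> y = y' \<or> \<not> s \<and> s' \<and> (x < x' \<or> y < y'))"
  by (auto simp: grid_order_def)

lemma finite_grid: "finite (grid N)"
proof (rule finite_subset)
  show "grid N \<subseteq> (\<lambda>(s, x, y). vert s x y) ` (UNIV \<times> {..<N} \<times> {..<N})"
    by (force simp: grid_def)
qed auto

lemma partial_order_on_grid: "partial_order_on (grid N) (grid_order N)"
  by (auto simp: partial_order_on_def preorder_on_def refl_on_def trans_def antisym_def
      grid_order_def)

section \<open>Boolean dimension of the grid poset\<close>

lemma grid_boolean_dimension_le:
  assumes "N \<ge> 2"
  shows "boolean_dimension (grid N) (grid_order N) \<le> 4"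
proof -
  \<comment> \<open>Lexicographic keys. \<open>k1\<close> and \<open>k2\<close> both put the lower
    copy first but order each copy oppositely, so together they hold only for equal points and for
    (lower, upper) pairs. \<open>k3\<close> and \<open>k4\<close> compare one coordinate; the entry
    \<open>- of_bool s\<close> puts upper points first on ties, so a lower point precedes an upper
    one only if that coordinate is strictly smaller.\<close>
  define k1 k2 k3 k4 :: "bool \<times> nat \<times> nat \<Rightarrow> int \<times> int \<times> int" where
    "k1 = (\<lambda>(s, x, y). (of_bool s, int x, int y))" and
    "k2 = (\<lambda>(s, x, y). (of_bool s, - int x, - int y))" and
    "k3 = (\<lambda>(s, x, y). (int x, - of_bool s, int y))" and
    "k4 = (\<lambda>(s, x, y). (int y, - of_bool s, int x))"
  note k_defs = k1_def k2_def k3_def k4_def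
  define L where "L k = {(u, v). u \<in> grid N \<and> v \<in> grid N \<and> k (from_nat u) \<le> k (from_nat v)}"
    for k :: "bool \<times> nat \<times> nat \<Rightarrow> int \<times> int \<times> int"
  have L_iff: "(vert s x y, vert s' x' y') \<in> L k \<longleftrightarrow>
      x < N \<and> y < N \<and> x' < N \<and> y' < N \<and> k (s, x, y) \<le> k (s', x', y')" for s x y s' x' y' k
    by (auto simp: L_def)
  have lin: "linear_order_on (grid N) (L k)" if "inj k" for k
    unfolding L_def
    by (rule linear_order_on_key) (use that in \<open>auto simp: inj_on_def grid_def dest: injD\<close>)
  have inj: "inj k1" "inj k2" "inj k3" "inj k4"
    by (auto simp: k_defs inj_on_def)
  \<comment> \<open>One separating pair for each two of the four orders, so that the realizer has
    exactly four elements; the coordinates 0 and 1 exist since \<open>N \<ge> 2\<close>.\<close>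
  have "(vert False 0 0, vert False 0 1) \<in> L k1 - L k2" "(vert False 1 1, vert True 0 0) \<in> L k1 - L k3"
    "(vert False 1 1, vert True 0 0) \<in> L k1 - L k4" "(vert False 1 1, vert True 0 0) \<in> L k2 - L k3"
    "(vert False 1 1, vert True 0 0) \<in> L k2 - L k4" "(vert False 0 1, vert False 1 0) \<in> L k3 - L k4"
    using assms by (auto simp: L_iff k_defs)
  then have dist: "distinct [L k1, L k2, L k3, L k4]"
    by auto
  define \<phi> where "\<phi> = Conj (Conj (Var 0) (Var 1)) (Disj (Var 2) (Var 3))"
  have eq: "(u, v) \<in> grid_order N \<longleftrightarrow> beval (\<lambda>i. (u, v) \<in> [L k1, L k2, L k3, L k4] ! i) \<phi>"
    if uv: "u \<in> grid N" "v \<in> grid N" for u v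
  proof -
    obtain s x y s' x' y' where "u = vert s x y" "v = vert s' x' y'"
      using uv by (auto simp: grid_def)
    with uv show ?thesis
      by (cases s; cases s') (auto simp: vert_grid_order_iff L_iff \<phi>_def k_defs numeral_eq_Suc)
  qed
  have "boolean_realizer (grid N) (grid_order N) (set [L k1, L k2, L k3, L k4])"
    unfolding boolean_realizer_def
  proof (intro conjI exI[of _ "[L k1, L k2, L k3, L k4]"] exI[of _ \<phi>] ballI)
    show "linear_order_on (grid N) R" if "R \<in> set [L k1, L k2, L k3, L k4]" for R
      using that lin inj by auto
    show "bvars \<phi> \<subseteq> {..<length [L k1, L k2, L k3, L k4]}"
      by (auto simp: \<phi>_def)
  qed (use dist eq in auto)
  moreover have "enat (card (set [L k1, L k2, L k3, L k4])) = 4"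
    using distinct_card[OF dist] by (simp add: numeral_eq_enat)
  ultimately show ?thesis
    unfolding boolean_dimension_def by (intro Inf_lower) auto
qed

lemma four_le_grid_boolean_dimension:
  "\<exists>M. \<forall>N\<ge>M. boolean_dimension (grid N) (grid_order N) \<ge> 4"
proof -
  \<comment> \<open>\<open>M\<close> must not depend on the realizer, so the colours allow truth
    vectors of every length up to 3.\<close>
  define C where "C = {xs :: bool list. length xs \<le> 3}"
  have "C = {xs. set xs \<subseteq> UNIV \<and> length xs \<le> 3}"
    by (auto simp: C_def)
  then have "finite C"
    by (metis finite_lists_length_le finite_UNIV)
  then have "finite (C \<times> C \<times> C \<times> C)"
    by simp
  from product_ramsey_pairs[OF this, of 4]
  obtain M :: nat where M: "\<forall>f. (\<forall>x x' y y'. x < x' \<and> x' < M \<and> y < y' \<and> y' < M \<longrightarrow>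
              f x x' y y' \<in> C \<times> C \<times> C \<times> C) \<longrightarrow>
           (\<exists>g h c. strict_mono_on {..<4} g \<and> g ` {..<4} \<subseteq> {..<M} \<and>
                    strict_mono_on {..<4} h \<and> h ` {..<4} \<subseteq> {..<M} \<and>
                  (\<forall>i j i' j'. i < j \<and> j < (4::nat) \<and> i' < j' \<and> j' < (4::nat) \<longrightarrow>
                     f (g i) (g j) (h i') (h j') = c))"
    by auto
  have "4 \<le> enat (card R)" if N: "N \<ge> M" and R: "boolean_realizer (grid N) (grid_order N) R" for N R
  proof (rule ccontr)
    assume "\<not> 4 \<le> enat (card R)"
    then have card: "card R \<le> 3"
      by (simp add: numeral_eq_enat)
    obtain Ls \<phi> where lin: "\<And>L. L \<in> set Ls \<Longrightarrow> linear_order_on (grid N) L" and "distinct Ls" "set Ls = R"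
      and vars: "bvars \<phi> \<subseteq> {..<length Ls}"
      and real: "\<And>x y. x \<in> grid N \<Longrightarrow> y \<in> grid N \<Longrightarrow>
         (x, y) \<in> grid_order N \<longleftrightarrow> beval (\<lambda>i. (x, y) \<in> Ls ! i) \<phi>"
      using R unfolding boolean_realizer_def by blast
    then have len: "length Ls \<le> 3"
      using card distinct_card by metis
    define v where "v = (\<lambda>x y. map (\<lambda>L. (x, y) \<in> L) Ls)"
    \<comment> \<open>The colour of a rectangle records the truth vectors at its antidiagonal
      corners \<open>(x, y')\<close> and \<open>(x', y)\<close>.\<close>
    define f where "f x x' y y' =
      (v (vert False x y') (vert True x' y), v (vert False x' y) (vert True x y'),
       v (vert False x y') (vert True x y'), v (vert False x y') (vert False x' y))" for x x' y y'
    have "\<forall>x x' y y'. f x x' y y' \<in> C \<times> C \<times> C \<times> C"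
      using len by (simp add: f_def v_def C_def)
    then obtain g h c where g: "strict_mono_on {..<4} g" "g ` {..<4} \<subseteq> {..<M}"
      and h: "strict_mono_on {..<4} h" "h ` {..<4} \<subseteq> {..<M}"
      and c: "\<And>i j i' j'. i < j \<Longrightarrow> j < (4::nat) \<Longrightarrow> i' < j' \<Longrightarrow> j' < (4::nat) \<Longrightarrow>
                     f (g i) (g j) (h i') (h j') = c"
      using M by metis
    have bounds: "g i < N" "h i < N" if "i < 4" for i
      using g h N that by fastforce+
    have lt: "g i < g j \<longleftrightarrow> i < j" "h i < h j \<longleftrightarrow> i < j" "g i = g j \<longleftrightarrow> i = j"
      if "i < 4" "j < 4" for i j
      using that strict_mono_on_less[OF g(1)] strict_mono_on_less[OF h(1)] strict_mono_on_eq[OF g(1)]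
      by auto
    \<comment> \<open>Reading \<open>h\<close> backwards gives an antidiagonal: for distinct indices
      exactly one coordinate increases, so the lower point \<open>a i\<close> is below
      \<open>b j\<close> iff \<open>i \<noteq> j\<close>.\<close>
    show False
    proof (rule no_ternary_boolean_realizer[OF lin len vars real, where
          a = "\<lambda>i. vert False (g i) (h (2 - i))" and b = "\<lambda>i. vert True (g i) (h (2 - i))" and c = c])
      fix i j :: nat assume "i < j" "j < 3"
      then have "f (g i) (g j) (h (2 - j)) (h (2 - i)) = c"
        by (intro c) auto
      then show "(map (\<lambda>L. (vert False (g i) (h (2 - i)), vert True (g j) (h (2 - j))) \<in> L) Ls,
         map (\<lambda>L. (vert False (g j) (h (2 - j)), vert True (g i) (h (2 - i))) \<in> L) Ls,
         map (\<lambda>L. (vert False (g i) (h (2 - i)), vert True (g i) (h (2 - i))) \<in> L) Ls,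
         map (\<lambda>L. (vert False (g i) (h (2 - i)), vert False (g j) (h (2 - j))) \<in> L) Ls) = c"
        by (simp add: f_def v_def)
    qed (use bounds lt in \<open>auto simp: vert_grid_order_iff\<close>)
  qed
  then show ?thesis
    unfolding boolean_dimension_def by (intro exI[of _ M] allI impI Inf_greatest) blast
qed

section \<open>Local dimension of the grid poset\<close>

lemma partial_linear_extension_trans:
  assumes "partial_linear_extension X P L" "(u, v) \<in> L" "(v, w) \<in> L"
  shows "(u, w) \<in> L"
  using assms
  by (meson partial_linear_extension_def linear_order_on_def partial_order_on_def preorder_on_def transD)

lemma partial_linear_extension_antisym:
  assumes "partial_linear_extension X P L" "(u, v) \<in> L" "(v, u) \<in> L"
  shows "u = v"
  using assms
  by (meson partial_linear_extension_def linear_order_on_def partial_order_on_def antisymD)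

lemma partial_linear_extension_extends:
  assumes "partial_linear_extension X P L" "(u, v) \<in> P" "u \<in> Field L" "v \<in> Field L"
  shows "(u, v) \<in> L"
  using assms by (auto simp: partial_linear_extension_def)

lemma grid_no_local_realizer:
  "\<exists>M. \<forall>N\<ge>M. \<not> (\<exists>R. local_realizer (grid N) (grid_order N) m R)"
proof -
  have "finite ({..<m} \<times> {..<m})"
    by simp
  from product_ramsey_pairs[OF this, of 4]
  obtain M :: nat where M: "\<forall>f. (\<forall>x x' y y'. x < x' \<and> x' < M \<and> y < y' \<and> y' < M \<longrightarrow>
              f x x' y y' \<in> {..<m} \<times> {..<m}) \<longrightarrow>
           (\<exists>g h c. strict_mono_on {..<4} g \<and> g ` {..<4} \<subseteq> {..<M} \<and>
                    strict_mono_on {..<4} h \<and> h ` {..<4} \<subseteq> {..<M} \<and>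
                  (\<forall>i j i' j'. i < j \<and> j < (4::nat) \<and> i' < j' \<and> j' < (4::nat) \<longrightarrow>
                     f (g i) (g j) (h i') (h j') = c))"
    by auto
  have False if N: "N \<ge> M" and R: "local_realizer (grid N) (grid_order N) m R" for N R
  proof -
    have fin: "finite R" and ext: "\<And>L. L \<in> R \<Longrightarrow> partial_linear_extension (grid N) (grid_order N) L"
      and card: "\<And>u. u \<in> grid N \<Longrightarrow> card {L \<in> R. u \<in> Field L} \<le> m"
      and real: "\<And>u v. u \<in> grid N \<Longrightarrow> v \<in> grid N \<Longrightarrow>
         (u, v) \<in> grid_order N \<longleftrightarrow> \<not> (\<exists>L\<in>R. (v, u) \<in> L \<and> v \<noteq> u)"
      using R by (auto simp: local_realizer_def)
    \<comment> \<open>The numbering is local: each vertex numbers only the at most \<open>m\<close>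
      extensions containing it, so the number of colours does not depend on \<open>N\<close> or on
      the size of \<open>R\<close>.\<close>
    have "\<exists>e. inj_on e {L \<in> R. u \<in> Field L} \<and> e ` {L \<in> R. u \<in> Field L} \<subseteq> {..<m}"
      if "u \<in> grid N" for u
    proof -
      have "finite {L \<in> R. u \<in> Field L}" "card {L \<in> R. u \<in> Field L} \<le> card {..<m}"
        using fin card[OF that] by auto
      from card_le_inj[OF this(1) _ this(2)] show ?thesis
        by auto
    qed
    then have "\<exists>e. \<forall>u\<in>grid N. inj_on (e u) {L \<in> R. u \<in> Field L} \<and>
        e u ` {L \<in> R. u \<in> Field L} \<subseteq> {..<m}"
      by (intro bchoice) blast
    then obtain e where e_inj: "\<And>u. u \<in> grid N \<Longrightarrow> inj_on (e u) {L \<in> R. u \<in> Field L}"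
      and e_lt: "\<And>u. u \<in> grid N \<Longrightarrow> e u ` {L \<in> R. u \<in> Field L} \<subseteq> {..<m}"
      by blast
    have "\<exists>L\<in>R. (vert True x y, vert False x' y') \<in> L"
      if "x < x'" "x' < N" "y < y'" "y' < N" for x x' y y'
      using real[of "vert False x' y'" "vert True x y"] that by (auto simp: vert_grid_order_iff)
    then obtain L where L: "\<And>x x' y y'. x < x' \<Longrightarrow> x' < N \<Longrightarrow> y < y' \<Longrightarrow> y' < N \<Longrightarrow>
        L x x' y y' \<in> R \<and> (vert True x y, vert False x' y') \<in> L x x' y y'"
      by metis
    define f where
      "f x x' y y' = (e (vert True x y) (L x x' y y'), e (vert False x' y') (L x x' y y'))"
      for x x' y y'
    have "f x x' y y' \<in> {..<m} \<times> {..<m}" if "x < x'" "x' < M" "y < y'" "y' < M" for x x' y y'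
    proof -
      have "L x x' y y' \<in> {L \<in> R. vert True x y \<in> Field L}"
        "L x x' y y' \<in> {L \<in> R. vert False x' y' \<in> Field L}"
        using L[of x x' y y'] that N by (auto intro: FieldI1 FieldI2)
      then show ?thesis
        using e_lt[of "vert True x y"] e_lt[of "vert False x' y'"] that N
        unfolding f_def by auto
    qed
    then obtain g h c where g: "strict_mono_on {..<4} g" "g ` {..<4} \<subseteq> {..<M}"
      and h: "strict_mono_on {..<4} h" "h ` {..<4} \<subseteq> {..<M}"
      and c: "\<And>i j i' j'. i < j \<Longrightarrow> j < (4::nat) \<Longrightarrow> i' < j' \<Longrightarrow> j' < (4::nat) \<Longrightarrow>
                     f (g i) (g j) (h i') (h j') = c"
      using M by metis
    have bounds: "g i < N" "h i < N" if "i < 4" for i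
      using g h N that by fastforce+
    have lt: "g i < g j \<longleftrightarrow> i < j" "h i < h j \<longleftrightarrow> i < j" if "i < 4" "j < 4" for i j
      using that strict_mono_on_less[OF g(1)] strict_mono_on_less[OF h(1)] by auto
    define K where "K i j i' j' = L (g i) (g j) (h i') (h j')" for i j i' j'
    have K: "K i j i' j' \<in> R" "(vert True (g i) (h i'), vert False (g j) (h j')) \<in> K i j i' j'"
      if "i < j" "j < 4" "i' < j'" "j' < 4" for i j i' j'
      using L[of "g i" "g j" "h i'" "h j'"] that lt bounds by (auto simp: K_def)
    have K_Field: "vert True (g i) (h i') \<in> Field (K i j i' j')"
        "vert False (g j) (h j') \<in> Field (K i j i' j')"
      if "i < j" "j < 4" "i' < j'" "j' < 4" for i j i' j'
      using K(2)[OF that] by (auto intro: FieldI1 FieldI2)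
    have same_lower: "K i j i' j' = K i k i' k'"
      if "i < j" "j < 4" "i' < j'" "j' < 4" "i < k" "k < 4" "i' < k'" "k' < 4" for i j i' j' k k'
    proof (rule inj_onD[OF e_inj[of "vert True (g i) (h i')"]])
      show "e (vert True (g i) (h i')) (K i j i' j') = e (vert True (g i) (h i')) (K i k i' k')"
        using c[of i j i' j'] c[of i k i' k'] that by (auto simp: f_def K_def)
    qed (use K(1) K_Field that bounds in auto)
    have same_upper: "K i j i' j' = K k j k' j'"
      if "i < j" "j < 4" "i' < j'" "j' < 4" "k < j" "k' < j'" for i j i' j' k k'
    proof (rule inj_onD[OF e_inj[of "vert False (g j) (h j')"]])
      show "e (vert False (g j) (h j')) (K i j i' j') = e (vert False (g j) (h j')) (K k j k' j')"
        using c[of i j i' j'] c[of k j k' j'] that by (auto simp: f_def K_def)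
    qed (use K(1) K_Field that bounds in auto)
    define Q where "Q = K 0 1 2 3"
    \<comment> \<open>\<open>K 0 1 2 3\<close> and \<open>K 2 3 0 1\<close> are linked through the top corner, the \<open>a\<close>-vertex at \<open>(g 3, h 3)\<close>.\<close>
    have "K 0 1 2 3 = K 0 3 2 3" "K 0 3 2 3 = K 2 3 0 3" "K 2 3 0 3 = K 2 3 0 1"
      by (rule same_lower same_upper; simp)+
    then have Q': "Q = K 2 3 0 1"
      by (simp add: Q_def)
    \<comment> \<open>The two reversed pairs are crossed: \<open>a\<close> is below
      \<open>b'\<close> by its first coordinate and \<open>a'\<close> is below \<open>b\<close> by
      its second. As \<open>Q\<close> extends these relations, it contains the cycle from
      \<open>a\<close> through \<open>b'\<close>, \<open>a'\<close>, \<open>b\<close> back to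
      \<open>a\<close>.\<close>
    define a b a' b' where
      "a = vert False (g 1) (h 3)" and "b = vert True (g 0) (h 2)" and
      "a' = vert False (g 3) (h 1)" and "b' = vert True (g 2) (h 0)"
    have Q: "partial_linear_extension (grid N) (grid_order N) Q"
      using ext K(1)[of 0 1 2 3] by (simp add: Q_def)
    have ba: "(b, a) \<in> Q" "(b', a') \<in> Q"
      unfolding a_def b_def a'_def b'_def
      using K(2)[of 0 1 2 3, folded Q_def] K(2)[of 2 3 0 1, folded Q'] by simp_all
    have "(a, b') \<in> grid_order N" "(a', b) \<in> grid_order N"
      using bounds lt by (auto simp: vert_grid_order_iff a_def b_def a'_def b'_def)
    then have "(a, b') \<in> Q" "(a', b) \<in> Q"
      using partial_linear_extension_extends[OF Q] ba by (auto intro: FieldI1 FieldI2)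
    then have "(a, b) \<in> Q"
      using ba partial_linear_extension_trans[OF Q] by blast
    then have "a = b"
      using ba partial_linear_extension_antisym[OF Q] by blast
    then show False
      by (simp add: a_def b_def)
  qed
  then show ?thesis
    by blast
qed

section \<open>Combining the two bounds\<close>

text \<open>Lets the exclusion of width \<open>m\<close> exclude all smaller widths as well.\<close>

lemma local_realizer_mono:
  assumes "local_realizer X P d R" "d \<le> m"
  shows "local_realizer X P m R"
  using assms le_trans unfolding local_realizer_def by blast

theorem mainTheorem2:
  fixes m :: nat
  assumes "m > 0"
  shows "\<exists>(X :: nat set) (P :: nat rel). finite X \<and> partial_order_on X P \<and>
           boolean_dimension X P = 4 \<and> local_dimension X P > enat m"
proof -
  obtain M1 where M1: "\<And>N. N \<ge> M1 \<Longrightarrow> boolean_dimension (grid N) (grid_order N) \<ge> 4"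
    using four_le_grid_boolean_dimension by blast
  obtain M2 where M2: "\<And>N R. N \<ge> M2 \<Longrightarrow> \<not> local_realizer (grid N) (grid_order N) m R"
    using grid_no_local_realizer by blast
  define N where "N = max 2 (max M1 M2)"
  have "boolean_dimension (grid N) (grid_order N) = 4"
    using M1[of N] grid_boolean_dimension_le[of N] by (intro antisym) (auto simp: N_def)
  \<comment> \<open>A lower bound on an infimum comes out non-strict, so the strict bound
    \<open>m\<close> is obtained through \<open>Suc m\<close>.\<close>
  moreover have "enat (Suc m) \<le> local_dimension (grid N) (grid_order N)"
    unfolding local_dimension_def
  proof (rule Inf_greatest)
    fix n assume "n \<in> {enat d |d. \<exists>R. local_realizer (grid N) (grid_order N) d R}"
    then obtain d R where n: "n = enat d" and R: "local_realizer (grid N) (grid_order N) d R"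
      by blast
    have "\<not> local_realizer (grid N) (grid_order N) m R"
      using M2[of N] by (simp add: N_def)
    then have "\<not> d \<le> m"
      using local_realizer_mono[OF R] by blast
    then show "enat (Suc m) \<le> n"
      by (simp add: n)
  qed
  then have "enat m < local_dimension (grid N) (grid_order N)"
    using less_le_trans[of "enat m" "enat (Suc m)"] by simp
  ultimately show ?thesis
    using finite_grid partial_order_on_grid by blast
qed

end
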